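(* Let $\mathcal Q$ be a 2-dimensional space form given by a space form vector $\mathfrak q$, and let $f\in\mathcal C_{\mathcal Q}$. Then $f$ is constrained elastic in $\mathcal Q$ if and only if its double-curvature circle congruence $\mathfrak c_0=\frac{\kappa_0}{2}\mathfrak f_{\bar1}+\mathfrak t_{\bar10}=\frac{\kappa_0}{2}\mathfrak f_1+\mathfrak t_{01}$ lies in a fixed linear complex, that is, there exists $a=\mathbb{R}\mathfrak a\in\mathbb P(\mathbb R^{3,2})$ such that $\langle\langle\mathfrak c_0,\mathfrak a\rangle\rangle=0$ holds for all circles of the congruence (i.e. at every vertex).
   Context: **Light cone model.** $\mathbb R^{3,2}$ is $\mathbb R^5$ with the inner product $\langle\langle x,y\rangle\rangle=x_1y_1+x_2y_2+x_3y_3-x_4y_4-x_5y_5$, and $\mathfrak p=(0,0,0,0,1)$. Points, oriented circles and oriented lines of $\mathbb R^2\cup\{\infty\}$ correspond to null lines $\mathbb R\mathfrak v$, $\mathfrak v\neq0$, $\langle\langle\mathfrak v,\mathfrak v\rangle\rangle=0$: the point $(x,y)$ to $(x,y,\frac12(1-x^2-y^2),\frac12(1+x^2+y^2),0)$, the oriented circle with center $(x,y)$ and radius $r\in\mathbb{R}\setminus\{0\}$ to $(x,y,\frac12(1-x^2-y^2+r^2),\frac12(1+x^2+y^2-r^2),r)$, the oriented line with unit normal $(x,y)$ and normal distance $d$ to $(x,y,-d,d,1)$, and $\infty$ to $(0,0,1,-1,0)$. Points are the null lines orthogonal to $\mathfrak p$. Two elements are in oriented contact (tangency with orientation, or incidence)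 iff their inner product vanishes. An element $a=\mathbb R\mathfrak a\in\mathbb P(\mathbb R^{3,2})$ (with $\mathfrak a\ne 0$) defines the linear circle complex of all null lines orthogonal to $\mathfrak a$. **Space forms.** A space form $\mathcal Q$ is given by a vector $\mathfrak q\neq0$ with $\langle\langle\mathfrak p,\mathfrak q\rangle\rangle=0$; its sectional curvature is $\varepsilon=\kappa_{\mathcal Q}=-\langle\langle\mathfrak q,\mathfrak q\rangle\rangle$. The geodesic curvature of a circle $\mathfrak s$ is $\langle\langle\mathfrak s,\mathfrak q\rangle\rangle/\langle\langle\mathfrak s,\mathfrak p\rangle\rangle$; geodesics are circles with $\langle\langle\mathfrak s,\mathfrak q\rangle\rangle=0$. **Curves.** $\mathcal V=\mathbb Z$ with edges between consecutive integers; $f_{\bar1},f_0,f_1$ denote values at three consecutive vertices, subscripts $\bar10,01$ the edges between them. $\mathcal C_{\mathcal Q}$ is the set of discrete curves $f:\mathcal V\to\mathcal Q$ with constant distance in $\mathcal Q$ between consecutive points, any three consecutive points pairwise distinct, all points on one side of the hyperbolic boundary if $\varepsilon<0$, consecutive points not antipodal if $\varepsilon>0$, together with consistently oriented geodesic edges. The point $f$ is lifted to $\mathfrak f$ with $\langle\langle\mathfrak f,\mathfrak q\rangle\rangle=-1$; the oriented geodesic through $f_0,f_1$ is lifted to the null vector $\mathfrak t_{01}$ with $\langle\langle\mathfrak t_{01},\mathfrak p\rangle\rangle=-1$, $\langle\langle\mathfrak t_{01},\mathfrak q\rangle\rangle=\langle\langle\mathfrak t_{01},\mathfrak f_0\rangle\rangle=\langle\langle\mathfrak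 t_{01},\mathfrak f_1\rangle\rangle=0$. Consistent orientation means that at each vertex there is a circle $\mathfrak c_0$ (the double-curvature circle) in oriented contact with the geodesic edges at $f_{\bar1}$ and $f_1$, i.e. $\mathfrak c_0=\frac{\kappa_0}{2}\mathfrak f_{\bar1}+\mathfrak t_{\bar10}=\frac{\kappa_0}{2}\mathfrak f_1+\mathfrak t_{01}$ with $\kappa_0\in\mathbb R$. The geodesic curvature of $f$ at $f_0$ is this $\kappa_0$, twice the geodesic curvature of $\mathfrak c_0$. The constant $\eta>0$ is defined by $\eta^2=-2\langle\langle\mathfrak f_0,\mathfrak f_1\rangle\rangle$, and $\zeta^2=\eta^2(1-\varepsilon\frac{\eta^2}{4})$. **Constrained elastic.** $f\in\mathcal C_{\mathcal Q}$ is constrained elastic in $\mathcal Q$ if there are constants $\xi,\delta\in\mathbb R$ with $\kappa_{\bar1}+\kappa_1=\dfrac{\xi\kappa_0+\delta}{1+\frac{\zeta^2}{4}\kappa_0^2}$ at every vertex.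
   Formalization: As stated, "linear complex implies constrained elastic" fails for curves with some but not all curvatures κ_0 zero (e.g. a rhombus with side midpoints); that direction is proved only when κ_0 is nowhere zero or identically zero, the converse for all f. *)

theory Defs
  imports "HOL-Analysis.Analysis"
begin

section \<open>The Lie sphere model\<close>

definition lip :: "real^5 \<Rightarrow> real^5 \<Rightarrow> real" where
  "lip x y = x$1 * y$1 + x$2 * y$2 + x$3 * y$3 - x$4 * y$4 - x$5 * y$5"

definition point_complex :: "real^5" where
  "point_complex = axis 5 1"

section \<open>Space forms\<close>

definition space_form :: "real^5 \<Rightarrow> bool" where
  "space_form q \<longleftrightarrow> q \<noteq> 0 \<and> lip point_complex q = 0"

definition sectional_curvature :: "real^5 \<Rightarrow> real" where
  "sectional_curvature q = - lip q q"

text \<open>A point of the space form is represented by the unique vector on its null line that is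
  normalized against \<open>q\<close>; null lines orthogonal to \<open>q\<close> have no such vector, they are the
  boundary points.\<close>

definition space_form_points :: "real^5 \<Rightarrow> (real^5) set" where
  "space_form_points q = {x. lip x x = 0 \<and> lip x point_complex = 0 \<and> lip x q = -1}"

text \<open>With the induced metric, \<open>space_form_points q\<close> is a plane, a sphere or a two-sheeted
  hyperboloid of constant curvature \<open>\<epsilon>\<close>. For \<open>\<epsilon> \<noteq> 0\<close> its centre is \<open>q / \<epsilon>\<close>, and
  \<open>\<epsilon> \<langle>x - q / \<epsilon>, y - q / \<epsilon>\<rangle> = 1 + \<epsilon> \<langle>x, y\<rangle>\<close> is the cosine (hyperbolic cosine) of the
  distance times \<open>sqrt \<bar>\<epsilon>\<bar>\<close>; for \<open>\<epsilon> < 0\<close> this is meaningful for points of the same sheet.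
  For \<open>\<epsilon> = 0\<close>, \<open>- 2 \<langle>x, y\<rangle>\<close> is the squared Euclidean distance.\<close>

definition space_form_dist :: "real^5 \<Rightarrow> real^5 \<Rightarrow> real^5 \<Rightarrow> real" where
  "space_form_dist q x y =
     (let \<epsilon> = sectional_curvature q in
      if \<epsilon> > 0 then arccos (1 + \<epsilon> * lip x y) / sqrt \<epsilon>
      else if \<epsilon> < 0 then arcosh (1 + \<epsilon> * lip x y) / sqrt (- \<epsilon>)
      else sqrt (- 2 * lip x y))"

definition antipodal :: "real^5 \<Rightarrow> real^5 \<Rightarrow> real^5 \<Rightarrow> bool" where
  "antipodal q x y \<longleftrightarrow> x + y = (2 / sectional_curvature q) *\<^sub>R q"

text \<open>A nonzero null vector orthogonal to \<open>point_complex\<close> has nonzero fourth coordinate. The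
  side of the hyperbolic boundary on which a point lies is the sign of \<open>lip v q\<close> for the
  representative \<open>v\<close> with positive fourth coordinate; for the representative \<open>x\<close> with
  \<open>lip x q = -1\<close> it is therefore read off from the sign of \<open>x $ 4\<close>.\<close>

definition on_one_side :: "(int \<Rightarrow> real^5) \<Rightarrow> bool" where
  "on_one_side f \<longleftrightarrow> (\<forall>i. f i $ 4 > 0) \<or> (\<forall>i. f i $ 4 < 0)"

section \<open>Discrete curves\<close>

text \<open>A curve consists of its normalized vertices \<open>f i\<close> and its normalized oriented geodesic
  edges, where \<open>t i\<close> is the edge from vertex \<open>i\<close> to vertex \<open>i + 1\<close>.\<close>

definition geodesic_edges :: "real^5 \<Rightarrow> (int \<Rightarrow> real^5) \<Rightarrow> (int \<Rightarrow> real^5) \<Rightarrow> bool" where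
  "geodesic_edges q f t \<longleftrightarrow>
     (\<forall>i. lip (t i) (t i) = 0 \<and> lip (t i) point_complex = -1 \<and> lip (t i) q = 0 \<and>
          lip (t i) (f i) = 0 \<and> lip (t i) (f (i + 1)) = 0)"

definition touching :: "(int \<Rightarrow> real^5) \<Rightarrow> (int \<Rightarrow> real^5) \<Rightarrow> int \<Rightarrow> real \<Rightarrow> bool" where
  "touching f t i k \<longleftrightarrow>
     (k / 2) *\<^sub>R f (i - 1) + t (i - 1) = (k / 2) *\<^sub>R f (i + 1) + t i"

definition consistently_oriented :: "(int \<Rightarrow> real^5) \<Rightarrow> (int \<Rightarrow> real^5) \<Rightarrow> bool" where
  "consistently_oriented f t \<longleftrightarrow> (\<forall>i. \<exists>k. touching f t i k)"

definition discrete_curve :: "real^5 \<Rightarrow> (int \<Rightarrow> real^5) \<Rightarrow> (int \<Rightarrow> real^5) \<Rightarrow> bool" where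
  "discrete_curve q f t \<longleftrightarrow>
     (\<forall>i. f i \<in> space_form_points q) \<and>
     (\<exists>d. \<forall>i. space_form_dist q (f i) (f (i + 1)) = d) \<and>
     (\<forall>i. f (i - 1) \<noteq> f i \<and> f i \<noteq> f (i + 1) \<and> f (i - 1) \<noteq> f (i + 1)) \<and>
     (sectional_curvature q < 0 \<longrightarrow> on_one_side f) \<and>
     (sectional_curvature q > 0 \<longrightarrow> (\<forall>i. \<not> antipodal q (f i) (f (i + 1)))) \<and>
     geodesic_edges q f t \<and>
     consistently_oriented f t"

text \<open>The number \<open>k\<close> is unique because \<open>f (i - 1) \<noteq> f (i + 1)\<close>.\<close>

definition curvature :: "(int \<Rightarrow> real^5) \<Rightarrow> (int \<Rightarrow> real^5) \<Rightarrow> int \<Rightarrow> real" where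
  "curvature f t i = (THE k. touching f t i k)"

definition double_curvature_circle :: "(int \<Rightarrow> real^5) \<Rightarrow> (int \<Rightarrow> real^5) \<Rightarrow> int \<Rightarrow> real^5" where
  "double_curvature_circle f t i = (curvature f t i / 2) *\<^sub>R f (i - 1) + t (i - 1)"

text \<open>Both quantities are the same for every edge of a discrete curve, since the distance of
  consecutive points is; they are read off from the edge between the vertices 0 and 1.\<close>

definition eta :: "(int \<Rightarrow> real^5) \<Rightarrow> real" where
  "eta f = sqrt (- 2 * lip (f 0) (f 1))"

definition zeta_squared :: "real^5 \<Rightarrow> (int \<Rightarrow> real^5) \<Rightarrow> real" where
  "zeta_squared q f = (eta f)\<^sup>2 * (1 - sectional_curvature q * (eta f)\<^sup>2 / 4)"

definition constrained_elastic :: "real^5 \<Rightarrow> (int \<Rightarrow> real^5) \<Rightarrow> (int \<Rightarrow> real^5) \<Rightarrow> bool" where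
  "constrained_elastic q f t \<longleftrightarrow>
     (\<exists>\<xi> \<delta>. \<forall>i. curvature f t (i - 1) + curvature f t (i + 1) =
        (\<xi> * curvature f t i + \<delta>) / (1 + zeta_squared q f / 4 * (curvature f t i)\<^sup>2))"

definition in_fixed_linear_complex :: "(int \<Rightarrow> real^5) \<Rightarrow> bool" where
  "in_fixed_linear_complex c \<longleftrightarrow> (\<exists>a. a \<noteq> 0 \<and> (\<forall>i. lip (c i) a = 0))"

text \<open>Without this condition, lying in a fixed linear complex does not imply being constrained
  elastic: at a vertex with curvature 0 whose point itself is orthogonal to \<open>a\<close>, the curvatures
  of the two neighbours are independent of each other. An example in the Euclidean plane is the
  closed curve through the corners \<open>(\<plusminus> 4, 0)\<close>, \<open>(0, \<plusminus> 3)\<close> of a rhombus and the midpoints of its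
  sides. Its curvatures are 0 at the midpoints and alternate between \<open>- 3/5\<close> and \<open>- 16/15\<close> at the
  corners, so no \<open>\<xi>\<close> and \<open>\<delta>\<close> exist, but its four sides and its four circles, each touching
  two adjacent sides at their midpoints, are orthogonal to \<open>a = (0, 0, 29, -21, -96/5)\<close>.\<close>

definition inflection_free_or_geodesic :: "(int \<Rightarrow> real^5) \<Rightarrow> (int \<Rightarrow> real^5) \<Rightarrow> bool" where
  "inflection_free_or_geodesic f t \<longleftrightarrow>
     (\<forall>i. curvature f t i \<noteq> 0) \<or> (\<forall>i. curvature f t i = 0)"

end

theory Submission
  imports Defs
begin

text \<open>Write \<open>h\<close> for the constant product of consecutive points, \<open>k\<close> for the curvature and \<open>c\<close> for
  the double-curvature circle at a vertex, and \<open>p\<close> for the point complex. Expanding \<open>f (i + 1)\<close> in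
  the frame \<open>f (i - 1)\<close>, \<open>f i\<close>, \<open>q\<close>, \<open>t (i - 1)\<close>, \<open>p\<close> gives the linear recursion
  \<open>(1 + \<zeta>\<^sup>2 k\<^sup>2 / 4) (f (i + 1) + f (i - 1)) = \<zeta>\<^sup>2 k (c - p) + 2 ((1 + \<epsilon> h) f i - h q)\<close>.
  If no curvature vanishes, circles \<open>c\<close> orthogonal to \<open>a\<close> force \<open>\<langle>f i, a\<rangle> = r k i\<close> with constant \<open>r\<close>.
  Pairing the recursion with \<open>a\<close> then gives the equation of constrained elastic curves for
  \<open>r \<noteq> 0\<close> and constant curvature for \<open>r = 0\<close>. Conversely, the constrained elastic
  equation propagates the relations \<open>\<langle>f i, a\<rangle> = k i\<close> and \<open>\<langle>t i, a\<rangle> = - k i k (i + 1) / 2\<close> from one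
  edge, where they can be solved for \<open>a\<close>, to all edges.\<close>

section \<open>The Lie inner product\<close>

lemma exhaust_5:
  fixes x :: 5
  shows "x = 1 \<or> x = 2 \<or> x = 3 \<or> x = 4 \<or> x = 5"
proof (induct x)
  case (of_int z)
  then have "z = 0 \<or> z = 1 \<or> z = 2 \<or> z = 3 \<or> z = 4"
    by (simp, arith)
  then show ?case
    by auto
qed

lemma forall_5: "(\<forall>i::5. P i) \<longleftrightarrow> P 1 \<and> P 2 \<and> P 3 \<and> P 4 \<and> P 5"
  by (metis exhaust_5)

lemma lip_bilinear:
  shows "lip (x + y) w = lip x w + lip y w"
    and "lip w (x + y) = lip w x + lip w y"
    and "lip (x - y) w = lip x w - lip y w"
    and "lip w (x - y) = lip w x - lip w y"
    and "lip (s *\<^sub>R x) w = s * lip x w"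
    and "lip w (s *\<^sub>R x) = s * lip w x"
  by (simp_all add: lip_def algebra_simps)

lemma lip_commute: "lip x y = lip y x"
  by (simp add: lip_def mult.commute)

lemma lip_zero: "lip 0 x = 0" "lip x 0 = 0"
  by (simp_all add: lip_def)

lemma lip_point_complex: "lip x point_complex = - x$5"
  by (simp add: lip_def point_complex_def axis_def)

lemma lip_nondegenerate:
  assumes "\<And>y. lip x y = 0"
  shows "x = 0"
proof -
  have "x $ i = 0" for i
    using assms[of "axis 1 1"] assms[of "axis 2 1"] assms[of "axis 3 1"]
      assms[of "axis 4 1"] assms[of "axis 5 1"] exhaust_5[of i]
    by (auto simp: lip_def axis_def)
  then show ?thesis
    by (simp add: vec_eq_iff)
qed

lemma Cauchy_Schwarz_3:
  fixes a b c x y z :: real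
  shows "(a*x + b*y + c*z)\<^sup>2 \<le> (a\<^sup>2 + b\<^sup>2 + c\<^sup>2) * (x\<^sup>2 + y\<^sup>2 + z\<^sup>2)"
proof -
  have "(a\<^sup>2 + b\<^sup>2 + c\<^sup>2) * (x\<^sup>2 + y\<^sup>2 + z\<^sup>2) - (a*x + b*y + c*z)\<^sup>2
      = (a*y - b*x)\<^sup>2 + (a*z - c*x)\<^sup>2 + (b*z - c*y)\<^sup>2"
    by (simp add: power2_eq_square algebra_simps)
  then show ?thesis
    by (smt (verit) zero_le_power2)
qed

lemma sum_3_squares_nonpos:
  fixes a b c :: real
  assumes "a\<^sup>2 + b\<^sup>2 + c\<^sup>2 \<le> 0"
  shows "a = 0 \<and> b = 0 \<and> c = 0"
proof -
  have "a\<^sup>2 \<le> 0" "b\<^sup>2 \<le> 0" "c\<^sup>2 \<le> 0"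
    using assms zero_le_power2[of a] zero_le_power2[of b] zero_le_power2[of c] by linarith+
  then show ?thesis
    by simp
qed

text \<open>The complement of \<open>point_complex\<close> has signature (3,1), and \<open>q\<close>
  is timelike or lightlike in it, so vectors of it orthogonal to \<open>q\<close> cannot be
  timelike. Concretely, Cauchy-Schwarz in the first three coordinates bounds
  \<open>w$4 * q$4\<close>; a timelike \<open>q\<close> gives definiteness.\<close>

lemma lip_nonneg_of_orthogonal:
  assumes "space_form q" "lip q q \<le> 0" "lip w point_complex = 0" "lip w q = 0"
  shows "0 \<le> lip w w" and "lip q q < 0 \<Longrightarrow> lip w w = 0 \<Longrightarrow> w = 0"
proof -
  define W where "W = (w$1)\<^sup>2 + (w$2)\<^sup>2 + (w$3)\<^sup>2"
  define R where "R = (q$1)\<^sup>2 + (q$2)\<^sup>2 + (q$3)\<^sup>2"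
  have nonneg: "W \<ge> 0" "R \<ge> 0"
    by (simp_all add: W_def R_def)
  have w5: "w$5 = 0" and q5: "q$5 = 0"
    using assms(1,3) lip_point_complex[of q] lip_point_complex[of w] lip_commute[of q point_complex]
    by (simp_all add: space_form_def)
  have ww: "lip w w = W - (w$4)\<^sup>2" and qq: "lip q q = R - (q$4)\<^sup>2"
    by (simp_all add: lip_def W_def R_def w5 q5 power2_eq_square)
  have q4: "q$4 \<noteq> 0"
  proof
    assume "q$4 = 0"
    then have "q$1 = 0" "q$2 = 0" "q$3 = 0"
      using sum_3_squares_nonpos[of "q$1" "q$2" "q$3"] assms(2) qq by (simp_all add: R_def)
    with \<open>q$4 = 0\<close> q5 have "q = 0"
      by (simp add: vec_eq_iff forall_5)
    then show False
      using assms(1) by (simp add: space_form_def)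
  qed
  have "w$1 * q$1 + w$2 * q$2 + w$3 * q$3 = w$4 * q$4"
    using assms(4) w5 by (simp add: lip_def)
  then have cs: "(w$4)\<^sup>2 * (q$4)\<^sup>2 \<le> W * R"
    using Cauchy_Schwarz_3[of "w$1" "q$1" "w$2" "q$2" "w$3" "q$3"]
    by (simp add: W_def R_def power_mult_distrib)
  have "W * R \<le> W * (q$4)\<^sup>2"
    using nonneg assms(2) qq by (intro mult_left_mono) auto
  with cs have "(w$4)\<^sup>2 * (q$4)\<^sup>2 \<le> W * (q$4)\<^sup>2"
    by linarith
  then show "0 \<le> lip w w"
    using q4 ww by (simp add: mult_le_cancel_right)
  show "w = 0" if "lip q q < 0" "lip w w = 0"
  proof -
    have "W * ((q$4)\<^sup>2 - R) \<le> 0"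
      using cs that(2) ww by (simp add: algebra_simps)
    then have "W = 0"
      using nonneg that(1) qq by (smt (verit) mult_pos_pos)
    then have "w$1 = 0" "w$2 = 0" "w$3 = 0"
      using sum_3_squares_nonpos[of "w$1" "w$2" "w$3"] by (simp_all add: W_def)
    moreover have "w$4 = 0"
      using \<open>W = 0\<close> ww that(2) by simp
    ultimately show ?thesis
      using w5 by (simp add: vec_eq_iff forall_5)
  qed
qed

section \<open>Points of a space form\<close>

lemma space_form_pointsD:
  assumes "x \<in> space_form_points q"
  shows "lip x x = 0" "lip x point_complex = 0" "lip x q = -1"
  using assms by (auto simp: space_form_points_def)

text \<open>Orthogonal null vectors of a space of signature (3,1) are proportional, and the
  normalization against \<open>q\<close> fixes the factor.\<close>

lemma space_form_points_eqI:
  assumes x: "x \<in> space_form_points q" and y: "y \<in> space_form_points q" and "lip x y = 0"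
  shows "x = y"
proof -
  note X = space_form_pointsD[OF x] and Y = space_form_pointsD[OF y]
  have 5: "x$5 = 0" "y$5 = 0"
    using X(2) Y(2) by (simp_all add: lip_point_complex)
  have nx: "x$1 * x$1 + x$2 * x$2 + x$3 * x$3 = x$4 * x$4"
    and ny: "y$1 * y$1 + y$2 * y$2 + y$3 * y$3 = y$4 * y$4"
    and xy: "x$1 * y$1 + x$2 * y$2 + x$3 * y$3 = x$4 * y$4"
    using X(1) Y(1) assms(3) 5 by (simp_all add: lip_def)
  \<comment> \<open>This is the squared length of \<open>x$4\<close> times the spatial part of
    \<open>y\<close> minus \<open>y$4\<close> times that of \<open>x\<close>.\<close>
  have "(x$4 * y$1 - y$4 * x$1)\<^sup>2 + (x$4 * y$2 - y$4 * x$2)\<^sup>2 + (x$4 * y$3 - y$4 * x$3)\<^sup>2 =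
      (x$4)\<^sup>2 * (y$1 * y$1 + y$2 * y$2 + y$3 * y$3) + (y$4)\<^sup>2 * (x$1 * x$1 + x$2 * x$2 + x$3 * x$3)
      - 2 * x$4 * y$4 * (x$1 * y$1 + x$2 * y$2 + x$3 * y$3)"
    by (simp add: power2_eq_square algebra_simps)
  also have "\<dots> = 0"
    unfolding nx ny xy by (simp add: power2_eq_square algebra_simps)
  finally have "x$4 * y$1 = y$4 * x$1" "x$4 * y$2 = y$4 * x$2" "x$4 * y$3 = y$4 * x$3"
    using sum_3_squares_nonpos[of "x$4 * y$1 - y$4 * x$1" "x$4 * y$2 - y$4 * x$2"
        "x$4 * y$3 - y$4 * x$3"] by simp_all
  then have par: "x$4 *\<^sub>R y = y$4 *\<^sub>R x"
    using 5 by (simp add: vec_eq_iff forall_5)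
  then have "lip (x$4 *\<^sub>R y) q = lip (y$4 *\<^sub>R x) q"
    by simp
  then have eq: "x$4 = y$4"
    using X Y by (simp add: lip_bilinear)
  have "x$4 \<noteq> 0"
  proof
    assume "x$4 = 0"
    with nx have "(x$1)\<^sup>2 + (x$2)\<^sup>2 + (x$3)\<^sup>2 = 0"
      by (simp add: power2_eq_square)
    then have "x$1 = 0" "x$2 = 0" "x$3 = 0"
      using sum_3_squares_nonpos[of "x$1" "x$2" "x$3"] by simp_all
    with \<open>x$4 = 0\<close> 5 have "x = 0"
      by (simp add: vec_eq_iff forall_5)
    with X(3) show False
      by (simp add: lip_zero)
  qed
  with par eq show ?thesis
    by simp
qed

text \<open>The spatial parts of null vectors have lengths \<open>\<bar>x$4\<bar>\<close> and
  \<open>\<bar>y$4\<bar>\<close>. Cauchy-Schwarz gives the bound, and equal signs of the fourth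
  coordinates remove the absolute values.\<close>

lemma lip_nonpos_same_side:
  assumes x: "x \<in> space_form_points q" and y: "y \<in> space_form_points q" and "x$4 * y$4 > 0"
  shows "lip x y \<le> 0"
proof -
  note X = space_form_pointsD[OF x] and Y = space_form_pointsD[OF y]
  have 5: "x$5 = 0" "y$5 = 0"
    using X(2) Y(2) by (simp_all add: lip_point_complex)
  have nx: "(x$1)\<^sup>2 + (x$2)\<^sup>2 + (x$3)\<^sup>2 = (x$4)\<^sup>2"
    and ny: "(y$1)\<^sup>2 + (y$2)\<^sup>2 + (y$3)\<^sup>2 = (y$4)\<^sup>2"
    using X(1) Y(1) 5 by (simp_all add: lip_def power2_eq_square)
  have "(x$1 * y$1 + x$2 * y$2 + x$3 * y$3)\<^sup>2 \<le> (x$4 * y$4)\<^sup>2"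
    using Cauchy_Schwarz_3[of "x$1" "y$1" "x$2" "y$2" "x$3" "y$3"]
    by (simp add: nx ny power_mult_distrib)
  then have "x$1 * y$1 + x$2 * y$2 + x$3 * y$3 \<le> x$4 * y$4"
    by (rule power2_le_imp_le) (use assms(3) in simp)
  then show ?thesis
    using 5 by (simp add: lip_def)
qed

text \<open>The difference \<open>x - y\<close> is orthogonal to \<open>q\<close> and
  \<open>point_complex\<close>, and its square is \<open>- 2 * lip x y\<close>.\<close>

lemma lip_nonpos_sphere_or_plane:
  assumes "space_form q" "sectional_curvature q \<ge> 0"
    and x: "x \<in> space_form_points q" and y: "y \<in> space_form_points q"
  shows "lip x y \<le> 0"
  using lip_nonneg_of_orthogonal(1)[of q "x - y"] assms(1,2)
    space_form_pointsD[OF x] space_form_pointsD[OF y]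
  by (simp add: lip_bilinear sectional_curvature_def lip_commute[of y x])

text \<open>The vector \<open>w\<close> below is the sum of the radius vectors of \<open>x\<close>
  and \<open>y\<close> from the centre \<open>q / e\<close>. Its square is nonnegative, and it
  vanishes exactly for antipodal points.\<close>

lemma lip_sphere_ge:
  assumes "space_form q" and pos: "sectional_curvature q > 0"
    and x: "x \<in> space_form_points q" and y: "y \<in> space_form_points q"
  shows "sectional_curvature q * lip x y \<ge> -2"
    and "sectional_curvature q * lip x y = -2 \<Longrightarrow> antipodal q x y"
proof -
  define e where "e = sectional_curvature q"
  have e: "e > 0" and qq: "lip q q = - e"
    using pos by (simp_all add: e_def sectional_curvature_def)
  note X = space_form_pointsD[OF x] and Y = space_form_pointsD[OF y]
  have qp: "lip q point_complex = 0"
    using assms(1) by (simp add: space_form_def lip_commute)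
  define w where "w = x + y - (2 / e) *\<^sub>R q"
  have wp: "lip w point_complex = 0" and wq: "lip w q = 0"
    using X Y qp qq e by (simp_all add: w_def lip_bilinear)
  have "lip w w = 2 * lip x y + 4 / e"
    using X Y qq e
    by (simp add: w_def lip_bilinear lip_commute[of y x] lip_commute[of q x] lip_commute[of q y]
        field_simps)
  then have ww: "e * lip w w = 2 * (e * lip x y + 2)"
    using e by (simp add: field_simps)
  have q0: "lip q q \<le> 0"
    using e qq by simp
  have "0 \<le> e * lip w w"
    using lip_nonneg_of_orthogonal(1)[OF assms(1) q0 wp wq] e by simp
  then show "sectional_curvature q * lip x y \<ge> -2"
    using ww by (simp add: e_def)
  show "antipodal q x y" if "sectional_curvature q * lip x y = -2"
  proof -
    have "lip w w = 0"
      using ww e that by (simp add: e_def[symmetric])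
    then have "w = 0"
      using lip_nonneg_of_orthogonal(2)[OF assms(1) q0 wp wq] e qq by simp
    then show ?thesis
      by (simp add: antipodal_def w_def e_def)
  qed
qed

section \<open>Frames along a discrete curve\<close>

lemma int_bidirectional_induct [case_names base up down]:
  fixes P :: "int \<Rightarrow> bool"
  assumes "P 0" "\<And>i. P i \<Longrightarrow> P (i + 1)" "\<And>i. P i \<Longrightarrow> P (i - 1)"
  shows "P n"
  by (induction n rule: int_induct[of _ 0]) (use assms in auto)

locale curve_in_space_form =
  fixes q :: "real^5" and f t :: "int \<Rightarrow> real^5"
  assumes space_form: "space_form q"
    and curve: "discrete_curve q f t"
begin

abbreviation e :: real where "e \<equiv> sectional_curvature q"
abbreviation h :: real where "h \<equiv> lip (f 0) (f 1)"
abbreviation z :: real where "z \<equiv> zeta_squared q f"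
abbreviation k :: "int \<Rightarrow> real" where "k \<equiv> curvature f t"
abbreviation c :: "int \<Rightarrow> real^5" where "c \<equiv> double_curvature_circle f t"
abbreviation p :: "real^5" where "p \<equiv> point_complex"

lemma f_points: "f i \<in> space_form_points q"
  using curve by (simp add: discrete_curve_def)

lemma f_distinct: "f i \<noteq> f (i + 1)" "f (i - 1) \<noteq> f (i + 1)"
  using curve by (auto simp: discrete_curve_def)

lemma q_products: "lip q q = - e" "lip q p = 0" "lip p q = 0" "lip p p = -1"
  using space_form lip_commute[of q p]
  by (simp_all add: sectional_curvature_def space_form_def)
    (simp add: lip_def point_complex_def axis_def)

lemma f_products:
  "lip (f i) (f i) = 0" "lip (f i) p = 0" "lip p (f i) = 0" "lip (f i) q = -1" "lip q (f i) = -1"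
  using space_form_pointsD[OF f_points[of i]] by (simp_all add: lip_commute)

lemma t_products:
  "lip (t i) (t i) = 0" "lip (t i) p = -1" "lip p (t i) = -1" "lip (t i) q = 0" "lip q (t i) = 0"
  "lip (t i) (f i) = 0" "lip (f i) (t i) = 0" "lip (t i) (f (i + 1)) = 0" "lip (f (i + 1)) (t i) = 0"
  using curve by (simp_all add: discrete_curve_def geodesic_edges_def lip_commute)

section \<open>Products of consecutive points and positivity of zeta squared\<close>

lemma lip_consecutive_nonpos: "lip (f i) (f (i + 1)) \<le> 0"
proof (cases "e < 0")
  case True
  then have "f i $ 4 * f (i + 1) $ 4 > 0"
    using curve by (auto simp: discrete_curve_def on_one_side_def mult_neg_neg)
  then show ?thesis
    using lip_nonpos_same_side[OF f_points f_points] by blast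
next
  case False
  then show ?thesis
    using lip_nonpos_sphere_or_plane[OF space_form _ f_points f_points] by simp
qed

text \<open>The distance determines the product: \<open>cos\<close> and \<open>cosh\<close> undo
  \<open>arccos\<close> and \<open>arcosh\<close> because the sign of the products, and on the
  sphere their lower bound, place the arguments in the right domain.\<close>

lemma lip_consecutive: "lip (f i) (f (i + 1)) = h"
proof -
  have "space_form_dist q (f i) (f (i + 1)) = space_form_dist q (f 0) (f (0 + 1))"
    using curve unfolding discrete_curve_def by metis
  then have d: "space_form_dist q (f i) (f (i + 1)) = space_form_dist q (f 0) (f 1)"
    by simp
  have h0: "h \<le> 0"
    using lip_consecutive_nonpos[of 0] by simp
  consider "e > 0" | "e < 0" | "e = 0"
    by linarith
  then show ?thesis
  proof cases
    case 1
    have "cos (arccos (1 + e * lip (f i) (f (i + 1)))) = cos (arccos (1 + e * h))"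
      using d 1 by (simp add: space_form_dist_def Let_def)
    moreover have "e * lip (f i) (f (i + 1)) \<le> 0" "e * h \<le> 0"
      using 1 h0 lip_consecutive_nonpos[of i] by (simp_all add: mult_nonneg_nonpos)
    moreover have "e * lip (f i) (f (i + 1)) \<ge> -2" "e * h \<ge> -2"
      using lip_sphere_ge(1)[OF space_form 1 f_points f_points] by auto
    ultimately show ?thesis
      using 1 by (simp add: cos_arccos)
  next
    case 2
    have "cosh (arcosh (1 + e * lip (f i) (f (i + 1)))) = cosh (arcosh (1 + e * h))"
      using d 2 by (simp add: space_form_dist_def Let_def)
    moreover have "e * lip (f i) (f (i + 1)) \<ge> 0" "e * h \<ge> 0"
      using 2 h0 lip_consecutive_nonpos[of i] by (simp_all add: mult_nonpos_nonpos)
    ultimately show ?thesis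
      using 2 by (simp add: cosh_arcosh_real)
  next
    case 3
    then show ?thesis
      using d by (simp add: space_form_dist_def Let_def)
  qed
qed

lemma lip_consecutive': "lip (f (i + 1)) (f i) = h"
  using lip_consecutive[of i] by (simp add: lip_commute)

lemma h_neg: "h < 0"
proof -
  have "h \<noteq> 0"
    using space_form_points_eqI[OF f_points f_points, of 0 1] f_distinct(1)[of 0] by auto
  then show ?thesis
    using lip_consecutive_nonpos[of 0] by simp
qed

text \<open>On a sphere the factor vanishes only for antipodal points. Its positivity makes both
  zeta squared positive and the frame of an edge nondegenerate.\<close>

lemma two_plus_e_h_pos: "2 + e * h > 0"
proof (cases "e > 0")
  case True
  moreover have "\<not> antipodal q (f 0) (f (0 + 1))"
    using True curve unfolding discrete_curve_def by blast
  ultimately show ?thesis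
    using lip_sphere_ge[OF space_form True f_points[of 0] f_points[of 1]]
    by (cases "e * h = -2") auto
next
  case False
  then have "e * h \<ge> 0"
    using h_neg by (simp add: mult_nonpos_nonpos)
  then show ?thesis
    by simp
qed

lemma zeta_squared_eq: "z = - h * (2 + e * h)"
  using h_neg by (simp add: zeta_squared_def eta_def algebra_simps)

lemma zeta_squared_pos: "z > 0"
  unfolding zeta_squared_eq using h_neg two_plus_e_h_pos by (simp add: mult_neg_pos)

lemma denominator_pos: "1 + z / 4 * (k i)\<^sup>2 > 0"
  using zeta_squared_pos by (simp add: add_pos_nonneg)

section \<open>Curvature, the frame of an edge and the recursion at a vertex\<close>

lemma touching_curvature: "touching f t i (k i)"
  unfolding curvature_def
proof (rule theI')
  obtain r where r: "touching f t i r"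
    using curve unfolding discrete_curve_def consistently_oriented_def by blast
  moreover have "s = r" if "touching f t i s" for s
  proof -
    have "(s / 2) *\<^sub>R (f (i - 1) - f (i + 1)) = t i - t (i - 1)"
      using that unfolding touching_def by (simp add: algebra_simps)
    moreover have "(r / 2) *\<^sub>R (f (i - 1) - f (i + 1)) = t i - t (i - 1)"
      using r unfolding touching_def by (simp add: algebra_simps)
    ultimately have "(s / 2 - r / 2) *\<^sub>R (f (i - 1) - f (i + 1)) = 0"
      by (simp add: scaleR_left_diff_distrib)
    then show ?thesis
      using f_distinct(2)[of i] by simp
  qed
  ultimately show "\<exists>!s. touching f t i s"
    by blast
qed

lemma circle_eq:
  "c i = (k i / 2) *\<^sub>R f (i - 1) + t (i - 1)" "c i = (k i / 2) *\<^sub>R f (i + 1) + t i"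
  using touching_curvature[of i] by (simp_all add: double_curvature_circle_def touching_def)

text \<open>The vectors \<open>t i - p\<close> and \<open>p\<close> are orthogonal to each other and
  to the other three, with squares 1 and -1, while \<open>f i\<close>, \<open>f (i + 1)\<close>,
  \<open>q\<close> have Gram determinant \<open>h * (2 + e * h)\<close>, which is nonzero.\<close>

lemma frame_spans:
  obtains \<alpha> \<beta> \<gamma> \<tau> \<pi> where
    "v = \<alpha> *\<^sub>R f i + \<beta> *\<^sub>R f (i + 1) + \<gamma> *\<^sub>R q + \<tau> *\<^sub>R (t i - p) + \<pi> *\<^sub>R p"
proof -
  define F :: "real^5 \<Rightarrow> real^5" where
    "F x = x$1 *\<^sub>R f i + x$2 *\<^sub>R f (i + 1) + x$3 *\<^sub>R q + x$4 *\<^sub>R (t i - p) + x$5 *\<^sub>R p" for x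
  have lin: "linear F"
    by (intro linearI) (simp_all add: F_def algebra_simps)
  have "x = 0" if "F x = 0" for x
  proof -
    have "lip (F x) y = 0" for y
      using that by (simp add: lip_zero)
    from this[of "f i"] this[of "f (i + 1)"] this[of q] this[of "t i"] this[of p]
    have 1: "x$2 * h - x$3 = 0" and 2: "x$1 * h - x$3 = 0"
      and 3: "- x$1 - x$2 - e * x$3 = 0" and "x$4 - x$5 = 0" "x$5 = 0"
      by (simp_all add: F_def lip_bilinear f_products t_products q_products
          lip_consecutive lip_consecutive' mult.commute)
    \<comment> \<open>This combination of the three equations eliminates \<open>x$1\<close> and
      \<open>x$2\<close>.\<close>
    moreover have "x$3 * (2 + e * h) = - (x$2 * h - x$3) - (x$1 * h - x$3) -
        h * (- x$1 - x$2 - e * x$3)"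
      by (simp add: algebra_simps)
    then have "x$3 = 0"
      using two_plus_e_h_pos 1 2 3 by simp
    ultimately show ?thesis
      using h_neg by (simp add: vec_eq_iff forall_5)
  qed
  then have "inj F"
    using lin by (simp add: linear_injective_0)
  then have "surj F"
    using linear_inj_imp_surj[OF lin] by simp
  then obtain x where "v = F x"
    by (metis surjD)
  then show ?thesis
    using that by (simp add: F_def)
qed

lemma eq_zero_if_orthogonal_to_frame:
  assumes "lip a (f i) = 0" "lip a (f (i + 1)) = 0" "lip a q = 0" "lip a (t i) = 0" "lip a p = 0"
  shows "a = 0"
proof (rule lip_nondegenerate)
  fix y
  obtain \<alpha> \<beta> \<gamma> \<tau> \<pi> where
    "y = \<alpha> *\<^sub>R f i + \<beta> *\<^sub>R f (i + 1) + \<gamma> *\<^sub>R q + \<tau> *\<^sub>R (t i - p) + \<pi> *\<^sub>R p"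
    by (rule frame_spans)
  then show "lip a y = 0"
    using assms by (simp add: lip_bilinear)
qed

lemma exists_with_frame_products:
  obtains a where "lip (f i) a = A" "lip (f (i + 1)) a = B" "lip q a = Q" "lip (t i) a = T"
    "lip p a = P"
proof -
  \<comment> \<open>The products with the two points fix their coefficients in terms of
    \<open>\<gamma>\<close>; the product with \<open>q\<close> then determines
    \<open>\<gamma>\<close>.\<close>
  define \<gamma> where "\<gamma> = - (h * Q + A + B) / (2 + e * h)"
  define a where "a = ((B + \<gamma>) / h) *\<^sub>R f i + ((A + \<gamma>) / h) *\<^sub>R f (i + 1) + \<gamma> *\<^sub>R q
    + (T - P) *\<^sub>R (t i - p) - P *\<^sub>R p"
  have "lip q a = - ((B + \<gamma>) / h) - (A + \<gamma>) / h - \<gamma> * e"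
    by (simp add: a_def lip_bilinear f_products t_products q_products)
  also have "\<dots> = - (A + B + \<gamma> * (2 + e * h)) / h"
    using h_neg by (simp add: field_simps)
  also have "\<dots> = Q"
    using h_neg two_plus_e_h_pos by (simp add: \<gamma>_def)
  finally have "lip q a = Q" .
  moreover have "lip (f i) a = A" "lip (f (i + 1)) a = B" "lip (t i) a = T" "lip p a = P"
    using h_neg by (simp_all add: a_def lip_bilinear f_products t_products q_products
        lip_consecutive lip_consecutive')
  ultimately show ?thesis
    using that by blast
qed

text \<open>The frame coefficients of \<open>f (i + 1)\<close> follow from its products with the
  frame and from its being null. Multiplying by the factor on the left eliminates the unknown
  product \<open>g\<close> of the two neighbours.\<close>

lemma vertex_recursion:
  "(1 + z / 4 * (k i)\<^sup>2) *\<^sub>R (f (i + 1) + f (i - 1)) =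
    (z * k i) *\<^sub>R (c i - p) + 2 *\<^sub>R ((1 + e * h) *\<^sub>R f i - h *\<^sub>R q)"
proof -
  let ?x = "f (i - 1)" and ?y = "f (i + 1)" and ?T = "t (i - 1)" and ?k = "k i"
  define g where "g = lip ?x ?y"
  have g: "lip ?y ?x = g"
    by (simp add: g_def lip_commute)
  have "g \<noteq> 0"
    using space_form_points_eqI[OF f_points f_points, of "i - 1" "i + 1"] f_distinct(2)[of i]
    by (auto simp: g_def)
  note prods = f_products t_products t_products(8,9)[of "i - 1", simplified] q_products g g_def[symmetric]
    lip_consecutive[of i] lip_consecutive'[of i]
    lip_consecutive[of "i - 1", simplified] lip_consecutive'[of "i - 1", simplified]
  \<comment> \<open>Pairing the two forms of the circle with \<open>f (i + 1)\<close> brings in the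
    curvature.\<close>
  have "(?k / 2) *\<^sub>R ?x + ?T = (?k / 2) *\<^sub>R ?y + t i"
    using circle_eq[of i] by simp
  then have "lip ((?k / 2) *\<^sub>R ?x + ?T) ?y = lip ((?k / 2) *\<^sub>R ?y + t i) ?y"
    by simp
  then have T: "lip ?T ?y = - ?k * g / 2" "lip ?y ?T = - ?k * g / 2"
    by (simp_all add: lip_bilinear prods lip_commute[of ?y ?T])
  obtain \<alpha> \<beta> \<gamma> \<tau> \<pi> where y: "?y = \<alpha> *\<^sub>R ?x + \<beta> *\<^sub>R f i + \<gamma> *\<^sub>R q + \<tau> *\<^sub>R (?T - p) + \<pi> *\<^sub>R p"
    by (rule frame_spans[of ?y "i - 1", simplified])
  have expand: "lip ?y v = \<alpha> * lip ?x v + \<beta> * lip (f i) v + \<gamma> * lip q v + \<tau> * (lip ?T v - lip p v)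
      + \<pi> * lip p v" for v
    by (subst y) (simp add: lip_bilinear)
  have \<pi>: "\<pi> = 0"
    using expand[of p] by (simp add: prods)
  have \<tau>: "\<tau> = - ?k * g / 2"
    using expand[of ?T] \<pi> by (simp add: prods T)
  have eq_x: "g = \<beta> * h - \<gamma>"
    using expand[of ?x] by (simp add: prods)
  have eq_f: "h = \<alpha> * h - \<gamma>"
    using expand[of "f i"] by (simp add: prods)
  have eq_q: "-1 = - \<alpha> - \<beta> - \<gamma> * e"
    using expand[of q] by (simp add: prods)
  \<comment> \<open>Nullity of \<open>f (i + 1)\<close> is quadratic, but a factor \<open>g\<close>
    splits off, and it is nonzero since the neighbours differ.\<close>
  have "0 = \<alpha> * g + (\<beta> * h - \<gamma>) + ?k\<^sup>2 * g\<^sup>2 / 4"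
    using expand[of ?y] \<pi> by (simp add: prods T \<tau> power2_eq_square mult_ac)
  then have "g * (\<alpha> + 1 + ?k\<^sup>2 * g / 4) = 0"
    unfolding eq_x[symmetric] by (simp add: power2_eq_square algebra_simps)
  then have \<alpha>: "\<alpha> = -1 - ?k\<^sup>2 * g / 4"
    using \<open>g \<noteq> 0\<close> by simp
  \<comment> \<open>All coefficients of the points and of \<open>q\<close> are expressed by
    \<open>m = 1 - \<alpha>\<close>; then \<open>g = - z * m\<close> turns the definition of
    \<open>m\<close> into \<open>D * m = 2\<close>.\<close>
  define m where "m = 2 + ?k\<^sup>2 * g / 4"
  have \<alpha>m: "\<alpha> = 1 - m"
    by (simp add: \<alpha> m_def)
  have \<gamma>: "\<gamma> = - m * h"
    using eq_f by (simp add: \<alpha>m algebra_simps)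
  have \<beta>: "\<beta> = m * (1 + e * h)"
    using eq_q by (simp add: \<alpha>m \<gamma> algebra_simps)
  have gz: "g = - z * m"
    using eq_x by (simp add: \<beta> \<gamma> zeta_squared_eq algebra_simps)
  define D where "D = 1 + z / 4 * ?k\<^sup>2"
  have "D * m = m + ?k\<^sup>2 / 4 * (z * m)"
    by (simp add: D_def algebra_simps)
  also have "z * m = - g"
    using gz by simp
  finally have Dm: "D * m = 2"
    by (simp add: m_def)
  \<comment> \<open>Since \<open>\<alpha> + 1 = (- ?k * g / 2) * (?k / 2)\<close>, the terms in
    \<open>f (i - 1)\<close> and \<open>t (i - 1)\<close> combine to a multiple of
    \<open>c i\<close>.\<close>
  have "?y + ?x = (- ?k * g / 2) *\<^sub>R (c i - p) + m *\<^sub>R ((1 + e * h) *\<^sub>R f i - h *\<^sub>R q)"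
    by (subst y) (simp add: \<pi> \<tau> \<alpha> \<beta> \<gamma> circle_eq(1) algebra_simps power2_eq_square)
  then have "D *\<^sub>R (?y + ?x) =
      (D * (- ?k * g / 2)) *\<^sub>R (c i - p) + (D * m) *\<^sub>R ((1 + e * h) *\<^sub>R f i - h *\<^sub>R q)"
    by (simp only: scaleR_add_right scaleR_scaleR)
  also have "D * (- ?k * g / 2) = z * ?k"
    using Dm gz by (simp add: field_simps)
  finally show ?thesis
    using Dm by (simp add: D_def)
qed

lemma orthogonal_recursion:
  assumes "lip (c i) a = 0"
  shows "(1 + z / 4 * (k i)\<^sup>2) * (lip (f (i + 1)) a + lip (f (i - 1)) a) =
    2 * (1 + e * h) * lip (f i) a - z * lip p a * k i - 2 * h * lip q a"
proof -
  have "lip ((1 + z / 4 * (k i)\<^sup>2) *\<^sub>R (f (i + 1) + f (i - 1))) a =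
    lip ((z * k i) *\<^sub>R (c i - p) + 2 *\<^sub>R ((1 + e * h) *\<^sub>R f i - h *\<^sub>R q)) a"
    by (simp only: vertex_recursion)
  then show ?thesis
    using assms unfolding lip_bilinear by (simp add: algebra_simps)
qed

section \<open>Constrained elastic curves and linear complexes\<close>

lemma constrained_elastic_iff:
  "constrained_elastic q f t \<longleftrightarrow>
    (\<exists>\<xi> \<delta>. \<forall>i. (1 + z / 4 * (k i)\<^sup>2) * (k (i + 1) + k (i - 1)) = \<xi> * k i + \<delta>)"
proof -
  have "k (i - 1) + k (i + 1) = s / (1 + z / 4 * (k i)\<^sup>2) \<longleftrightarrow>
      (1 + z / 4 * (k i)\<^sup>2) * (k (i + 1) + k (i - 1)) = s" for i s
    using denominator_pos[of i] by (simp add: eq_divide_eq mult.commute add.commute)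
  then show ?thesis
    by (simp add: constrained_elastic_def)
qed

text \<open>The circles are now the geodesic edges themselves, so \<open>q\<close> serves as
  \<open>a\<close>.\<close>

lemma geodesic_in_fixed_linear_complex:
  assumes "\<And>i. k i = 0"
  shows "in_fixed_linear_complex c"
  unfolding in_fixed_linear_complex_def
proof (intro exI conjI allI)
  show "q \<noteq> 0"
    using space_form by (simp add: space_form_def)
  show "lip (c i) q = 0" for i
    by (simp add: circle_eq(1) assms t_products)
qed

lemma constrained_elastic_imp_linear_complex:
  assumes "constrained_elastic q f t"
  shows "in_fixed_linear_complex c"
\<comment> \<open>For a geodesic the vector constructed below could be zero; otherwise some product
  \<open>k i\<close> shows that it is not.\<close>
proof (cases "\<forall>i. k i = 0")
  case True
  then show ?thesis
    by (simp add: geodesic_in_fixed_linear_complex)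
next
  case False
  obtain \<xi> \<delta> where el: "\<And>i. (1 + z / 4 * (k i)\<^sup>2) * (k (i + 1) + k (i - 1)) = \<xi> * k i + \<delta>"
    using assms by (auto simp: constrained_elastic_iff)
  \<comment> \<open>The products with \<open>q\<close> and \<open>p\<close> turn the recursion for
    \<open>lip (f i) a\<close> into the elastic equation; the product with \<open>t 0\<close> makes
    \<open>c 0\<close> and \<open>c 1\<close> orthogonal to \<open>a\<close>.\<close>
  obtain a where a: "lip (f 0) a = k 0" "lip (f (0 + 1)) a = k (0 + 1)" "lip q a = - \<delta> / (2 * h)"
    "lip (t 0) a = - k 0 * k (0 + 1) / 2" "lip p a = (2 * (1 + e * h) - \<xi>) / z"
    by (rule exists_with_frame_products)
  have "z * lip p a = 2 * (1 + e * h) - \<xi>" "2 * h * lip q a = - \<delta>"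
    using zeta_squared_pos h_neg by (simp_all add: a)
  then have rec: "lip (f (i + 1)) a + lip (f (i - 1)) a = k (i + 1) + k (i - 1)"
    if "lip (c i) a = 0" "lip (f i) a = k i" for i
    using orthogonal_recursion[OF that(1)] el[of i] that(2) denominator_pos[of i]
    by (smt (verit) left_diff_distrib mult_cancel_left)
  \<comment> \<open>The relations on one edge make the circle at its end vertex orthogonal to
    \<open>a\<close>. The recursion then yields the next point, and the other form of the same
    circle yields the next edge.\<close>
  have edge: "lip (f i) a = k i \<and> lip (f (i + 1)) a = k (i + 1) \<and>
      lip (t i) a = - k i * k (i + 1) / 2" for i
  proof (induction i rule: int_bidirectional_induct)
    case base
    then show ?case
      using a by simp
  next
    case (up i)
    have ca: "lip (c (i + 1)) a = 0"
      using up by (simp add: circle_eq(1)[of "i + 1"] lip_bilinear)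
    have "lip (f (i + 1 + 1)) a = k (i + 1 + 1)"
      using rec[OF ca] up by simp
    moreover from this ca have "lip (t (i + 1)) a = - k (i + 1) * k (i + 1 + 1) / 2"
      by (simp add: circle_eq(2)[of "i + 1"] lip_bilinear)
    ultimately show ?case
      using up by simp
  next
    case (down i)
    have ca: "lip (c i) a = 0"
      using down by (simp add: circle_eq(2)[of i] lip_bilinear)
    have "lip (f (i - 1)) a = k (i - 1)"
      using rec[OF ca] down by simp
    moreover from this ca have "lip (t (i - 1)) a = - k (i - 1) * k i / 2"
      by (simp add: circle_eq(1)[of i] lip_bilinear mult.commute)
    ultimately show ?case
      using down by simp
  qed
  have "a \<noteq> 0"
    using False edge by (auto simp: lip_zero)
  moreover have "lip (c i) a = 0" for i
    using edge[of i] by (simp add: circle_eq(2)[of i] lip_bilinear)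
  ultimately show ?thesis
    unfolding in_fixed_linear_complex_def by blast
qed

lemma constant_curvature_constrained_elastic:
  assumes "\<And>i. k i = r"
  shows "constrained_elastic q f t"
  unfolding constrained_elastic_iff
  by (rule exI[of _ "2 * (1 + z / 4 * r\<^sup>2)"], rule exI[of _ 0]) (simp add: assms)

lemma linear_complex_imp_constrained_elastic:
  assumes "in_fixed_linear_complex c" and nonzero: "\<And>i. k i \<noteq> 0"
  shows "constrained_elastic q f t"
proof -
  obtain a where "a \<noteq> 0" and ca: "\<And>i. lip (c i) a = 0"
    using assms(1) by (auto simp: in_fixed_linear_complex_def)
  \<comment> \<open>The edge \<open>t i\<close> occurs in the circles at both of its ends; comparing
    the two values makes \<open>lip (f i) a / k i\<close> independent of \<open>i\<close>.\<close>
  have ta: "lip (t i) a = - (k i / 2) * lip (f (i + 1)) a"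
      "lip (t i) a = - (k (i + 1) / 2) * lip (f i) a" for i
    using ca[of i] ca[of "i + 1"]
    by (simp_all add: circle_eq(2)[of i] circle_eq(1)[of "i + 1"] lip_bilinear)
  define r where "r = lip (f 0) a / k 0"
  have "lip (f i) a / k i = r" for i
  proof -
    have step: "lip (f (i + 1)) a / k (i + 1) = lip (f i) a / k i" for i
      using ta[of i] nonzero[of i] nonzero[of "i + 1"] by (simp add: field_simps)
    show ?thesis
    proof (induction i rule: int_bidirectional_induct)
      case (down i)
      then show ?case
        using step[of "i - 1"] by simp
    qed (simp_all add: r_def step)
  qed
  then have fa: "lip (f i) a = r * k i" for i
    using nonzero[of i] by (metis nonzero_divide_eq_eq)
  define A B where "A = 2 * (1 + e * h) * r - z * lip p a" and "B = 2 * h * lip q a"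
  have rec: "r * ((1 + z / 4 * (k i)\<^sup>2) * (k (i + 1) + k (i - 1))) = A * k i - B" for i
    using orthogonal_recursion[OF ca[of i]] by (simp add: fa A_def B_def algebra_simps)
  show ?thesis
  proof (cases "r = 0")
    case False
    then have "(1 + z / 4 * (k i)\<^sup>2) * (k (i + 1) + k (i - 1)) = (A * k i - B) / r" for i
      using rec[of i] by (metis nonzero_mult_div_cancel_left)
    then have "(1 + z / 4 * (k i)\<^sup>2) * (k (i + 1) + k (i - 1)) = A / r * k i + - B / r" for i
      by (simp add: diff_divide_distrib)
    then show ?thesis
      unfolding constrained_elastic_iff by blast
  next
    \<comment> \<open>All points are now orthogonal to \<open>a\<close>, so the recursion has only
      its \<open>p\<close> and \<open>q\<close> terms left. It forces constant curvature unless
      \<open>lip p a = 0\<close>, and then \<open>a\<close> would be orthogonal to a whole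
      frame.\<close>
    case True
    have lin: "z * lip p a * k i = - 2 * h * lip q a" for i
      using rec[of i] True by (simp add: A_def B_def)
    have "lip p a \<noteq> 0"
    proof
      assume P: "lip p a = 0"
      then have "lip q a = 0"
        using lin[of 0] h_neg by simp
      then have "a = 0"
        using P fa ta True by (intro eq_zero_if_orthogonal_to_frame[of a 0]) 
          (simp_all add: lip_commute[of a "f 0"] lip_commute[of a "f 1"] lip_commute[of a q]
            lip_commute[of a "t 0"] lip_commute[of a p])
      with \<open>a \<noteq> 0\<close> show False ..
    qed
    then have "k i = - 2 * h * lip q a / (z * lip p a)" for i
      using lin[of i] zeta_squared_pos by (simp add: field_simps)
    then show ?thesis
      by (rule constant_curvature_constrained_elastic)
  qed
qed

end

theorem mainTheorem3:
  fixes q :: "real^5" and f t :: "int \<Rightarrow> real^5"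
  assumes "space_form q"
    and "discrete_curve q f t"
  shows "(constrained_elastic q f t \<longrightarrow>
            in_fixed_linear_complex (double_curvature_circle f t)) \<and>
         (inflection_free_or_geodesic f t \<longrightarrow>
            (constrained_elastic q f t \<longleftrightarrow>
             in_fixed_linear_complex (double_curvature_circle f t)))"
proof -
  interpret curve_in_space_form q f t
    using assms by unfold_locales
  \<comment> \<open>For a geodesic both sides hold: constant curvature 0 is constrained elastic, and
    the forward implication supplies the complex.\<close>
  show ?thesis
    using constrained_elastic_imp_linear_complex linear_complex_imp_constrained_elastic
      constant_curvature_constrained_elastic[of 0]
    unfolding inflection_free_or_geodesic_def by blast
qed

end
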